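(* Let $\mathcal{F}:\mathcal{P}_2(\mathbf{R}^d)\to\mathbf{R}$ be a functional with gradient $\mathcal{G}_{\mathcal{F}}$, let $L>0$, and assume that $\mathcal{F}$ is transport convex and transport $L$-smooth. Let $\mu_*\in\mathcal{P}_2(\mathbf{R}^d)$ be a minimizer of $\mathcal{F}$ over $\mathcal{P}_2(\mathbf{R}^d)$, let $\mu_0\in\mathcal{P}_2(\mathbf{R}^d)$, and assume that $\mu_*=(X_* )_\#\mu_0$ for some map $X_*\in L^2(\mathbf{R}^d\to\mathbf{R}^d)$. Let $\gamma>0$ satisfy $\gamma\le 3/(2L)$, define maps $X_n:\mathbf{R}^d\to\mathbf{R}^d$ by $$X_0(x)=x,\qquad X_{n+1}(x)=X_n(x)-\gamma\,\mathcal{G}_{\mathcal{F}}[(X_n)_\#\mu_0](X_n(x))\qquad(n=0,1,2,\ldots),$$ and let $\hat\mu_n:=(X_n)_\#\mu_0$. Then $\mathcal{F}(\hat\mu_n)-\mathcal{F}(\mu_* )=\mathrm{O}(1/n)$ as $n\to\infty$.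
   Context: $\mathcal{P}_2(\mathbf{R}^d)$ is the set of probability measures on $\mathbf{R}^d$ with finite second-order moment; $\|\cdot\|$ and $\langle\cdot,\cdot\rangle$ are the Euclidean norm and inner product; $F_\#\mu$ is the push-forward of $\mu$ by $F$; integrals are over $\mathbf{R}^d$. $L^2(\mathbf{R}^d\to\mathbf{R}^d)$ is the set of maps $\mathbf{R}^d\to\mathbf{R}^d$ that are square integrable with respect to the base measure being pushed forward ($\mu$ in the definitions below, $\mu_0$ for $X_*$). All push-forward measures at which $\mathcal{F}$ or $\mathcal{G}_{\mathcal{F}}$ is evaluated are understood to lie in $\mathcal{P}_2(\mathbf{R}^d)$. Gradient: a function $\mathcal{G}_{\mathcal{F}}[\cdot](\cdot):\mathcal{P}_2(\mathbf{R}^d)\times\mathbf{R}^d\to\mathbf{R}^d$ is a gradient of $\mathcal{F}$ if for every $\mu_0\in\mathcal{P}_2(\mathbf{R}^d)$ and every $X:[0,\infty)\times\mathbf{R}^d\to\mathbf{R}^d$ differentiable in the first variable, with $\mu_t:=X(t,\cdot)_\#\mu_0$, one has $\frac{\mathrm{d}}{\mathrm{d}t}\mathcal{F}(\mu_t)=\int\langle\mathcal{G}_{\mathcal{F}}[\mu_t](X(t,x)),\frac{\partial}{\partial t}X(t,x)\rangle\,\mathrm{d}\mu_0(x)$. Transport convex: $\mathcal{F}(T_\#\mu)-\mathcal{F}(S_\#\mu)\ge\int\langle\mathcal{G}_{\mathcal{F}}[S_\#\mu](S(x)),T(x)-S(x)\rangle\,\mathrm{d}\mu(x)$ for any $S,T\in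 L^2(\mathbf{R}^d\to\mathbf{R}^d)$ and $\mu\in\mathcal{P}_2(\mathbf{R}^d)$. Transport $L$-smooth: $\mathcal{F}(T_\#\mu)-\mathcal{F}(S_\#\mu)\le\int\langle\mathcal{G}_{\mathcal{F}}[S_\#\mu](S(x)),T(x)-S(x)\rangle\,\mathrm{d}\mu(x)+\frac L2\int\|T(x)-S(x)\|^2\,\mathrm{d}\mu(x)$ for any $S,T\in L^2(\mathbf{R}^d\to\mathbf{R}^d)$ and $\mu\in\mathcal{P}_2(\mathbf{R}^d)$. *)

theory Defs
  imports "HOL-Probability.Probability" "HOL-Library.Landau_Symbols"
begin

definition P2 :: "'a::euclidean_space measure set" where
  "P2 = {\<mu>. prob_space \<mu> \<and> sets \<mu> = sets borel \<and> integrable \<mu> (\<lambda>x. (norm x)\<^sup>2)}"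

definition L2_maps :: "'a::euclidean_space measure \<Rightarrow> ('a \<Rightarrow> 'a) set" where
  "L2_maps \<mu> = {T. T \<in> borel_measurable \<mu> \<and> integrable \<mu> (\<lambda>x. (norm (T x))\<^sup>2)}"

abbreviation push :: "('a::euclidean_space \<Rightarrow> 'a) \<Rightarrow> 'a measure \<Rightarrow> 'a measure" where
  "push T \<mu> \<equiv> distr \<mu> borel T"

(* For \<mu> in P2 and a measurable map T, T is in L2_maps \<mu> iff push T \<mu> is in P2; the first
   conjunct therefore says that all measures on the curve lie in P2.
   X' is the derivative in the first variable, one-sided at time 0. Besides existing pointwise,
   it is required to be the derivative in L2(\<mu>0). Pointwise differentiability alone
   would allow curves along which no differentiation under the integral sign is possible
   (even x \<mapsto> integral of (norm x)^2 would then have no gradient). The restriction only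
   makes "G is a gradient of F" easier to satisfy, so a theorem assuming it is stronger. *)
definition test_curve ::
  "'a::euclidean_space measure \<Rightarrow> (real \<Rightarrow> 'a \<Rightarrow> 'a) \<Rightarrow> (real \<Rightarrow> 'a \<Rightarrow> 'a) \<Rightarrow> bool" where
  "test_curve \<mu>0 X X' \<longleftrightarrow>
     (\<forall>t\<ge>0. X t \<in> L2_maps \<mu>0 \<and>
       (\<forall>x. ((\<lambda>s. X s x) has_vector_derivative X' t x) (at t within {0..})) \<and>
       X' t \<in> L2_maps \<mu>0 \<and>
       ((\<lambda>s. LINT x|\<mu>0. (norm ((X s x - X t x) /\<^sub>R (s - t) - X' t x))\<^sup>2) \<longlongrightarrow> 0)
         (at t within {0..}))"

(* Functionals and gradients are total on all measures; only their values on P2 are used.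
   Here and below integrability of the integrand is stated explicitly, since the Bochner
   integral of a non-integrable function is 0 by convention. *)
definition is_gradient ::
  "('a::euclidean_space measure \<Rightarrow> real) \<Rightarrow> ('a measure \<Rightarrow> 'a \<Rightarrow> 'a) \<Rightarrow> bool" where
  "is_gradient F G \<longleftrightarrow>
     (\<forall>\<mu>0\<in>P2. \<forall>X X'. test_curve \<mu>0 X X' \<longrightarrow>
       (\<forall>t\<ge>0.
         integrable \<mu>0 (\<lambda>x. G (push (X t) \<mu>0) (X t x) \<bullet> X' t x) \<and>
         ((\<lambda>s. F (push (X s) \<mu>0)) has_real_derivative
            (LINT x|\<mu>0. G (push (X t) \<mu>0) (X t x) \<bullet> X' t x)) (at t within {0..})))"

definition transport_convex ::
  "('a::euclidean_space measure \<Rightarrow> real) \<Rightarrow> ('a measure \<Rightarrow> 'a \<Rightarrow> 'a) \<Rightarrow> bool" where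
  "transport_convex F G \<longleftrightarrow>
     (\<forall>\<mu>\<in>P2. \<forall>S\<in>L2_maps \<mu>. \<forall>T\<in>L2_maps \<mu>.
       integrable \<mu> (\<lambda>x. G (push S \<mu>) (S x) \<bullet> (T x - S x)) \<and>
       F (push T \<mu>) - F (push S \<mu>) \<ge> (LINT x|\<mu>. G (push S \<mu>) (S x) \<bullet> (T x - S x)))"

definition transport_smooth ::
  "real \<Rightarrow> ('a::euclidean_space measure \<Rightarrow> real) \<Rightarrow> ('a measure \<Rightarrow> 'a \<Rightarrow> 'a) \<Rightarrow> bool" where
  "transport_smooth L F G \<longleftrightarrow>
     (\<forall>\<mu>\<in>P2. \<forall>S\<in>L2_maps \<mu>. \<forall>T\<in>L2_maps \<mu>.
       integrable \<mu> (\<lambda>x. G (push S \<mu>) (S x) \<bullet> (T x - S x)) \<and>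
       F (push T \<mu>) - F (push S \<mu>)
         \<le> (LINT x|\<mu>. G (push S \<mu>) (S x) \<bullet> (T x - S x))
           + L / 2 * (LINT x|\<mu>. (norm (T x - S x))\<^sup>2))"

end

theory Submission imports Defs begin

text \<open>Write \<open>f(S) = F(push S \<mu>0)\<close> for \<open>S\<close> in \<open>L\<^sup>2(\<mu>0)\<close>. Transport convexity and smoothness say that
  \<open>f\<close> is convex and \<open>L\<close>-smooth with gradient \<open>g(S) = G(push S \<mu>0) \<circ> S\<close>, so the iteration is gradient
  descent in the Hilbert space \<open>L\<^sup>2(\<mu>0)\<close>. With \<open>\<delta>\<^sub>n = f(X\<^sub>n) - f(X\<^sub>*)\<close>, smoothness and
  \<open>\<gamma> \<le> 3 / (2L)\<close> give \<open>\<gamma> \<parallel>g(X\<^sub>n)\<parallel>\<^sup>2 / 4 \<le> \<delta>\<^sub>n - \<delta>\<^sub>n\<^sub>+\<^sub>1\<close>, and together with convexity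
  the potential \<open>\<parallel>X\<^sub>n - X\<^sub>*\<parallel>\<^sup>2 + 2\<gamma> (n + 2) \<delta>\<^sub>n\<close> does not increase. That the iterates stay in
  \<open>L\<^sup>2(\<mu>0)\<close> is not assumed: it follows because \<open>f\<close> is bounded below.\<close>

lemma L2_maps_measurable: "T \<in> L2_maps \<mu> \<Longrightarrow> T \<in> borel_measurable \<mu>"
  by (simp add: L2_maps_def)

lemma L2_maps_integrable: "T \<in> L2_maps \<mu> \<Longrightarrow> integrable \<mu> (\<lambda>x. (norm (T x))\<^sup>2)"
  by (simp add: L2_maps_def)

lemma L2_maps_add:
  assumes "S \<in> L2_maps \<mu>" "T \<in> L2_maps \<mu>"
  shows "(\<lambda>x. S x + T x) \<in> L2_maps \<mu>"
proof -
  note [measurable] = assms[THEN L2_maps_measurable]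
  have "integrable \<mu> (\<lambda>x. (norm (S x + T x))\<^sup>2)"
  proof (rule Bochner_Integration.integrable_bound)
    show "integrable \<mu> (\<lambda>x. 2 * (norm (S x))\<^sup>2 + 2 * (norm (T x))\<^sup>2)"
      using assms[THEN L2_maps_integrable] by simp
    have "(norm (S x + T x))\<^sup>2 \<le> 2 * (norm (S x))\<^sup>2 + 2 * (norm (T x))\<^sup>2" for x
      using power_mono[OF norm_triangle_ineq norm_ge_zero, of "S x" "T x" 2]
        sum_squares_bound[of "norm (S x)" "norm (T x)"]
      by (simp add: power2_sum)
    then show "AE x in \<mu>. norm ((norm (S x + T x))\<^sup>2)
        \<le> norm (2 * (norm (S x))\<^sup>2 + 2 * (norm (T x))\<^sup>2)"
      by simp
  qed measurable
  then show ?thesis by (simp add: L2_maps_def)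
qed

lemma L2_maps_scaleR:
  assumes "T \<in> L2_maps \<mu>"
  shows "(\<lambda>x. c *\<^sub>R T x) \<in> L2_maps \<mu>"
  using assms by (auto simp: L2_maps_def power_mult_distrib)

lemma L2_maps_diff:
  assumes "S \<in> L2_maps \<mu>" "T \<in> L2_maps \<mu>"
  shows "(\<lambda>x. S x - T x) \<in> L2_maps \<mu>"
  using L2_maps_add[OF assms(1) L2_maps_scaleR[OF assms(2), of "-1"]] by simp

lemma L2_maps_bounded:
  assumes "\<mu> \<in> P2" "T \<in> borel_measurable \<mu>" "\<And>x. norm (T x) \<le> B"
  shows "T \<in> L2_maps \<mu>"
proof -
  interpret prob_space \<mu> using assms(1) by (simp add: P2_def)
  have "integrable \<mu> (\<lambda>x. (norm (T x))\<^sup>2)"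
    using assms(2,3) by (intro integrable_const_bound[where B="B\<^sup>2"]) (auto intro!: power_mono)
  then show ?thesis using assms(2) by (simp add: L2_maps_def)
qed

lemma push_in_P2:
  assumes "\<mu> \<in> P2" "T \<in> L2_maps \<mu>"
  shows "push T \<mu> \<in> P2"
  using assms prob_space.prob_space_distr[of \<mu> T borel]
  by (auto simp: P2_def L2_maps_def integrable_distr_eq)

lemma transport_smoothD:
  assumes "transport_smooth L F G" "\<mu> \<in> P2" "S \<in> L2_maps \<mu>" "T \<in> L2_maps \<mu>"
  shows "integrable \<mu> (\<lambda>x. G (push S \<mu>) (S x) \<bullet> (T x - S x))"
    and "F (push T \<mu>) - F (push S \<mu>) \<le> (LINT x|\<mu>. G (push S \<mu>) (S x) \<bullet> (T x - S x))
      + L / 2 * (LINT x|\<mu>. (norm (T x - S x))\<^sup>2)"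
  using assms unfolding transport_smooth_def by blast+

text \<open>Smoothness makes the pairing of the gradient with every L2 displacement integrable,
  hence measurable; displacing \<open>S\<close> by a constant basis vector \<open>e\<close> isolates
  one coordinate of the gradient.\<close>

lemma gradient_measurable:
  assumes smooth: "transport_smooth L F G" and \<mu>: "\<mu> \<in> P2" and S: "S \<in> L2_maps \<mu>"
  shows "(\<lambda>x. G (push S \<mu>) (S x)) \<in> borel_measurable \<mu>"
proof (rule borel_measurable_euclidean_space[THEN iffD2], intro ballI)
  fix e :: 'a assume "e \<in> Basis"
  have "(\<lambda>x. S x + e) \<in> L2_maps \<mu>"
    by (intro L2_maps_add S L2_maps_bounded[OF \<mu>, where B="norm e"]) auto
  then have "integrable \<mu> (\<lambda>x. G (push S \<mu>) (S x) \<bullet> (S x + e - S x))"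
    by (rule transport_smoothD(1)[OF smooth \<mu> S])
  then show "(\<lambda>x. G (push S \<mu>) (S x) \<bullet> e) \<in> borel_measurable \<mu>"
    by (simp add: borel_measurable_integrable)
qed

text \<open>The hypothesis \<open>gh\<close> covers both directions needed later: the truncated
  gradient, before the gradient is known to be square integrable, and the gradient itself.\<close>

lemma transport_smooth_step:
  assumes smooth: "transport_smooth L F G" and \<mu>: "\<mu> \<in> P2" and S: "S \<in> L2_maps \<mu>"
    and h: "h \<in> L2_maps \<mu>"
    and gh: "\<And>x. G (push S \<mu>) (S x) \<bullet> h x = (norm (h x))\<^sup>2"
  shows "F (push (\<lambda>x. S x - c *\<^sub>R h x) \<mu>) - F (push S \<mu>)
    \<le> - c * (1 - L * c / 2) * (LINT x|\<mu>. (norm (h x))\<^sup>2)"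
proof -
  let ?T = "\<lambda>x. S x - c *\<^sub>R h x"
  have "?T \<in> L2_maps \<mu>" by (intro L2_maps_diff L2_maps_scaleR S h)
  then have "F (push ?T \<mu>) - F (push S \<mu>) \<le> (LINT x|\<mu>. G (push S \<mu>) (S x) \<bullet> (?T x - S x))
      + L / 2 * (LINT x|\<mu>. (norm (?T x - S x))\<^sup>2)"
    by (rule transport_smoothD(2)[OF smooth \<mu> S])
  also have "\<dots> = - c * (1 - L * c / 2) * (LINT x|\<mu>. (norm (h x))\<^sup>2)"
    by (simp add: gh power_mult_distrib) (simp add: algebra_simps power2_eq_square)
  finally show ?thesis .
qed

text \<open>Stepping by \<open>-1/L\<close> along the gradient truncated at norm \<open>k\<close> decreases \<open>F\<close> by at least
  \<open>1/(2L)\<close> times its squared \<open>L\<^sup>2\<close> norm, so the lower bound on \<open>F\<close> bounds these norms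
  uniformly in \<open>k\<close>.\<close>
lemma gradient_in_L2:
  assumes smooth: "transport_smooth L F G" and L: "L > 0"
    and lb: "\<And>\<nu>. \<nu> \<in> P2 \<Longrightarrow> m \<le> F \<nu>"
    and \<mu>: "\<mu> \<in> P2" and S: "S \<in> L2_maps \<mu>"
  shows "(\<lambda>x. G (push S \<mu>) (S x)) \<in> L2_maps \<mu>"
proof -
  define g where "g = (\<lambda>x. G (push S \<mu>) (S x))"
  have g[measurable]: "g \<in> borel_measurable \<mu>"
    unfolding g_def by (rule gradient_measurable[OF smooth \<mu> S])
  define h where "h k x = (if norm (g x) \<le> real k then g x else 0)" for k x
  have h_meas[measurable]: "h k \<in> borel_measurable \<mu>" for k
    unfolding h_def by measurable
  have h: "h k \<in> L2_maps \<mu>" for k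
    by (rule L2_maps_bounded[OF \<mu> h_meas, where B="real k"]) (simp add: h_def)
  have bound: "(LINT x|\<mu>. (norm (h k x))\<^sup>2) \<le> 2 * L * (F (push S \<mu>) - m)" for k
  proof -
    have "(\<lambda>x. S x - (1 / L) *\<^sub>R h k x) \<in> L2_maps \<mu>"
      by (intro L2_maps_diff L2_maps_scaleR S h)
    then have "m \<le> F (push (\<lambda>x. S x - (1 / L) *\<^sub>R h k x) \<mu>)"
      by (intro lb push_in_P2 \<mu>)
    moreover have "G (push S \<mu>) (S x) \<bullet> h k x = (norm (h k x))\<^sup>2" for x
      by (simp add: h_def g_def power2_norm_eq_inner)
    ultimately have "(LINT x|\<mu>. (norm (h k x))\<^sup>2) / (2 * L) \<le> F (push S \<mu>) - m"
      using transport_smooth_step[OF smooth \<mu> S h, of k "1 / L"] L by simp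
    then show ?thesis
      using L by (simp add: pos_divide_le_eq mult.commute)
  qed
  have mono: "mono (\<lambda>k. (norm (h k x))\<^sup>2)" for x
    by (auto simp: mono_def h_def)
  \<comment> \<open>The integrals increase and \<open>bound\<close> is uniform in \<open>k\<close>,
    so they converge. Pointwise the truncation is inactive once \<open>k\<close> reaches
    \<open>norm (g x)\<close>, so monotone convergence carries integrability over to the full
    gradient.\<close>
  have "incseq (\<lambda>k. LINT x|\<mu>. (norm (h k x))\<^sup>2)"
    using mono by (auto simp: mono_def intro!: integral_mono L2_maps_integrable h)
  then obtain l where l: "(\<lambda>k. LINT x|\<mu>. (norm (h k x))\<^sup>2) \<longlonglongrightarrow> l"
    using incseq_convergent bound by blast
  have "integrable \<mu> (\<lambda>x. (norm (g x))\<^sup>2)"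
  proof (rule integrable_monotone_convergence)
    have "(\<lambda>k. (norm (h k x))\<^sup>2) \<longlonglongrightarrow> (norm (g x))\<^sup>2" for x
    proof (rule tendsto_eventually)
      show "\<forall>\<^sub>F k in sequentially. (norm (h k x))\<^sup>2 = (norm (g x))\<^sup>2"
        using eventually_ge_at_top[of "nat \<lceil>norm (g x)\<rceil>"]
        by eventually_elim (auto simp: h_def nat_le_iff ceiling_le_iff)
    qed
    then show "AE x in \<mu>. (\<lambda>k. (norm (h k x))\<^sup>2) \<longlonglongrightarrow> (norm (g x))\<^sup>2" by simp
  qed (use mono l L2_maps_integrable[OF h] in auto)
  then show ?thesis using g by (simp add: L2_maps_def g_def)
qed

text \<open>Integrability of the cross term is a hypothesis because transport convexity supplies it
  directly.\<close>

lemma integral_norm_diff_step: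
  assumes "D \<in> L2_maps \<mu>" "g \<in> L2_maps \<mu>" "integrable \<mu> (\<lambda>x. g x \<bullet> D x)"
  shows "(LINT x|\<mu>. (norm (D x - c *\<^sub>R g x))\<^sup>2) = (LINT x|\<mu>. (norm (D x))\<^sup>2)
    - 2 * c * (LINT x|\<mu>. g x \<bullet> D x) + c\<^sup>2 * (LINT x|\<mu>. (norm (g x))\<^sup>2)"
proof -
  have "(norm (D x - c *\<^sub>R g x))\<^sup>2 = (norm (D x))\<^sup>2 - 2 * c * (g x \<bullet> D x) + c\<^sup>2 * (norm (g x))\<^sup>2" for x
    unfolding power2_norm_eq_inner
    by (simp add: inner_diff_left inner_diff_right inner_commute[of "D x" "g x"] power2_eq_square right_diff_distrib)
  then show ?thesis
    using assms(3) assms(1,2)[THEN L2_maps_integrable] by simp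
qed

theorem theorem5p3:
  fixes F :: "(real ^ 'd) measure \<Rightarrow> real"
    and G :: "(real ^ 'd) measure \<Rightarrow> real ^ 'd \<Rightarrow> real ^ 'd"
    and \<mu>0 \<mu>star :: "(real ^ 'd) measure"
    and Xstar :: "real ^ 'd \<Rightarrow> real ^ 'd"
    and X :: "nat \<Rightarrow> real ^ 'd \<Rightarrow> real ^ 'd"
    and L \<gamma> :: real
  assumes "is_gradient F G"
    and "L > 0"
    and "transport_convex F G"
    and "transport_smooth L F G"
    and "\<mu>star \<in> P2" and "\<forall>\<nu>\<in>P2. F \<mu>star \<le> F \<nu>"
    and "\<mu>0 \<in> P2"
    and "Xstar \<in> L2_maps \<mu>0" and "\<mu>star = push Xstar \<mu>0"
    and "\<gamma> > 0" and "\<gamma> \<le> 3 / (2 * L)"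
    and "\<And>x. X 0 x = x"
    and "\<And>n x. X (Suc n) x = X n x - \<gamma> *\<^sub>R G (push (X n) \<mu>0) (X n x)"
  shows "(\<lambda>n. F (push (X n) \<mu>0) - F \<mu>star) \<in> O(\<lambda>n. 1 / real n)"
proof -
  note smooth = assms(4) and \<mu>0 = assms(7)
  define g where "g n x = G (push (X n) \<mu>0) (X n x)" for n x
  have X_Suc: "X (Suc n) = (\<lambda>x. X n x - \<gamma> *\<^sub>R g n x)" for n
    using assms(13) by (auto simp: g_def)
  have g_L2: "g n \<in> L2_maps \<mu>0" if "X n \<in> L2_maps \<mu>0" for n
    using gradient_in_L2[OF smooth assms(2) _ \<mu>0 that, of "F \<mu>star"] assms(6)
    by (simp add: g_def[abs_def])
  have X: "X n \<in> L2_maps \<mu>0" for n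
  proof (induction n)
    case 0
    have "X 0 = (\<lambda>x. x)" using assms(12) by auto
    then show ?case
      using \<mu>0 by (auto simp: L2_maps_def P2_def cong: measurable_cong_sets)
  next
    case (Suc n)
    then show ?case unfolding X_Suc by (intro L2_maps_diff L2_maps_scaleR g_L2)
  qed
  define \<delta> where "\<delta> n = F (push (X n) \<mu>0) - F \<mu>star" for n
  define A where "A n = (LINT x|\<mu>0. (norm (g n x))\<^sup>2)" for n
  define D where "D n = (LINT x|\<mu>0. (norm (X n x - Xstar x))\<^sup>2)" for n
  have \<delta>_ge0: "\<delta> n \<ge> 0" for n
    using assms(6) push_in_P2[OF \<mu>0 X] by (simp add: \<delta>_def)
  have A_ge0: "A n \<ge> 0" and D_ge0: "D n \<ge> 0" for n
    by (simp_all add: A_def D_def)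
  have descent: "\<gamma> * A n \<le> 4 * (\<delta> n - \<delta> (Suc n))" for n
  proof -
    have "\<delta> (Suc n) - \<delta> n \<le> - \<gamma> * (1 - L * \<gamma> / 2) * A n"
      using transport_smooth_step[OF smooth \<mu>0 X g_L2[OF X], of n n \<gamma>]
      by (simp add: \<delta>_def A_def X_Suc g_def power2_norm_eq_inner)
    moreover have "1 / 4 \<le> 1 - L * \<gamma> / 2"
      using assms(2,11) by (simp add: field_simps)
    then have "1 / 4 * (\<gamma> * A n) \<le> (1 - L * \<gamma> / 2) * (\<gamma> * A n)"
      using assms(10) A_ge0[of n] by (intro mult_right_mono) auto
    ultimately show ?thesis by (simp add: algebra_simps)
  qed
  have dist_step: "D (Suc n) \<le> D n - 2 * \<gamma> * \<delta> n + \<gamma> * (\<gamma> * A n)" for n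
  proof -
    \<comment> \<open>Convexity between \<open>X n\<close> and the optimal map \<open>Xstar\<close>,
      whose push-forward is the minimizer, bounds the cross term of the expanded square.\<close>
    have conv: "integrable \<mu>0 (\<lambda>x. g n x \<bullet> (Xstar x - X n x))"
      "(LINT x|\<mu>0. g n x \<bullet> (Xstar x - X n x)) \<le> - \<delta> n"
      using assms(3,8,9) \<mu>0 X unfolding transport_convex_def g_def \<delta>_def by fastforce+
    have neg: "g n x \<bullet> (X n x - Xstar x) = - (g n x \<bullet> (Xstar x - X n x))" for x
      by (simp add: inner_diff_right)
    have "D (Suc n) = (LINT x|\<mu>0. (norm ((X n x - Xstar x) - \<gamma> *\<^sub>R g n x))\<^sup>2)"
      by (simp add: D_def X_Suc algebra_simps)
    also have "\<dots> = D n - 2 * \<gamma> * (LINT x|\<mu>0. g n x \<bullet> (X n x - Xstar x)) + \<gamma>\<^sup>2 * A n"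
      unfolding D_def A_def
      using conv(1) by (intro integral_norm_diff_step L2_maps_diff X g_L2 assms(8)) (simp add: neg)
    also have "(LINT x|\<mu>0. g n x \<bullet> (X n x - Xstar x)) = - (LINT x|\<mu>0. g n x \<bullet> (Xstar x - X n x))"
      by (simp add: neg)
    finally show ?thesis
      using mult_left_mono[OF conv(2), of "2 * \<gamma>"] assms(10)
      by (simp add: power2_eq_square)
  qed
  \<comment> \<open>The shift by 2 absorbs the gradient term of \<open>dist_step\<close>: by
    \<open>descent\<close>, \<open>\<gamma> * (\<gamma> * A n)\<close> is at most
    \<open>4 * \<gamma> * (\<delta> n - \<delta> (Suc n))\<close>, which is exactly the decrease of
    \<open>2 * \<gamma> * 2 * \<delta> n\<close>.\<close>
  define V where "V n = D n + 2 * \<gamma> * (real n + 2) * \<delta> n" for n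
  have "V n \<le> V 0" for n
  proof (induction n)
    case (Suc n)
    have "\<gamma> * (\<gamma> * A n) \<le> \<gamma> * (4 * (\<delta> n - \<delta> (Suc n)))"
      using descent assms(10) by (intro mult_left_mono) auto
    moreover have "0 \<le> 4 * (\<delta> n - \<delta> (Suc n))"
      using assms(10) A_ge0[of n] by (intro order_trans[OF _ descent]) simp
    then have "\<delta> (Suc n) \<le> \<delta> n" by simp
    then have "2 * \<gamma> * (real n + 1) * \<delta> (Suc n) \<le> 2 * \<gamma> * (real n + 1) * \<delta> n"
      using assms(10) by (intro mult_left_mono) auto
    \<comment> \<open>After cancellation, \<open>V (Suc n) - V n\<close> is at most \<open>2 *
      \<gamma> * (real n + 1) * (\<delta> (Suc n) - \<delta> n)\<close>, which is nonpositive by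
      monotonicity of \<delta>.\<close>
    ultimately have "V (Suc n) \<le> V n"
      using dist_step[of n] by (simp add: V_def algebra_simps)
    with Suc show ?case by simp
  qed simp
  then have rate: "real n * \<delta> n \<le> V 0 / (2 * \<gamma>)" for n
  proof -
    have "2 * \<gamma> * (real n * \<delta> n) \<le> V n"
      using assms(10) D_ge0[of n] \<delta>_ge0[of n] by (simp add: V_def algebra_simps)
    with \<open>V n \<le> V 0\<close> show ?thesis using assms(10) by (simp add: field_simps)
  qed
  show ?thesis
  proof (rule bigoI[where c="V 0 / (2 * \<gamma>)"])
    show "\<forall>\<^sub>F n in sequentially. norm (F (push (X n) \<mu>0) - F \<mu>star)
        \<le> V 0 / (2 * \<gamma>) * norm (1 / real n)"
      \<comment> \<open>At \<open>n = 0\<close> the right-hand side is 0, since division by zero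
        yields 0, so only positive \<open>n\<close> are considered.\<close>
      using eventually_gt_at_top[of 0]
    proof eventually_elim
      case (elim n)
      then have "\<delta> n \<le> V 0 / (2 * \<gamma>) / real n"
        using rate[of n] by (subst pos_le_divide_eq) (simp_all add: mult.commute)
      then show ?case
        using \<delta>_ge0[of n] by (simp add: \<delta>_def)
    qed
  qed
qed

end
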